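(* Let $G$ be a finite group, $C=(\mathcal X,\mathcal K)$ a supercharacter theory of $G$, and $N\unlhd G$ a $C$-normal subgroup. If $G$ is $C$-quasi-monomial, then $G/N$ is $C^{G/N}$-quasi-monomial.
   Context: $\operatorname{Irr}(G)$ is the set of complex irreducible characters of $G$; $\lambda^G$ denotes induction. A supercharacter theory of $G$ is a pair $C=(\mathcal X,\mathcal K)$ with $\mathcal X$ a partition of $\operatorname{Irr}(G)$ and $\mathcal K$ a partition of $G$ such that $\{1\}\in\mathcal K$, $|\mathcal X|=|\mathcal K|$, and for each $X\in\mathcal X$ the character $\sigma_X=\sum_{\psi\in X}\psi(1)\psi$ is constant on each $K\in\mathcal K$. Given $C$ with $\mathcal X=\{X_1,\ldots,X_m\}$, $G$ is $C$-quasi-monomial if for every $k$ there exist subgroups $H_1,\ldots,H_t\leqslant G$ and linear characters $\lambda_i$ of $H_i$ with $\lambda_1^G+\cdots+\lambda_t^G=d\sigma_{X_k}$ for some positive integer $d$. A normal subgroup $N$ is $C$-normal if it is a union of members of $\mathcal K$. Identify $\operatorname{Irr}(G/N)$ with $\{\chi\in\operatorname{Irr}(G):N\subseteq\operatorname{Ker}\chi\}$ via $\widetilde\chi(gN)=\chi(g)$. When $N$ is $C$-normal, $\operatorname{Irr}(G/N)$ is a union of members of $\mathcal X$, and $C^{G/N}=(\widetilde{\mathcal X},\widetilde{\mathcal K})$ is the supercharacter theory of $G/N$ where $\widetilde{\mathcal X}$ consists of the sets $\widetilde X=\{\widetilde\chi:\chi\in X\}$ for those $X\in\mathcal X$ all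 of whose members contain $N$ in their kernel, and $\widetilde{\mathcal K}=\{KN/N:K\in\mathcal K\}$. *)

theory Defs
  imports Complex_Main "HOL-Library.Disjoint_Sets" "HOL-Algebra.Coset"
    "Jordan_Normal_Form.VS_Connect"
begin

text \<open>
  A complex representation of degree \<open>n\<close> is a homomorphism into the group of invertible
  complex \<open>n\<close> by \<open>n\<close> matrices.
\<close>

definition representation ::
    "('a, 'b) monoid_scheme \<Rightarrow> nat \<Rightarrow> ('a \<Rightarrow> complex mat) \<Rightarrow> bool" where
  "representation G n \<rho> \<longleftrightarrow> \<rho> \<in> hom G (units_of (ring_mat TYPE(complex) n ()))"

definition irreducible_representation ::
    "('a, 'b) monoid_scheme \<Rightarrow> nat \<Rightarrow> ('a \<Rightarrow> complex mat) \<Rightarrow> bool" where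
  "irreducible_representation G n \<rho> \<longleftrightarrow> representation G n \<rho> \<and> n > 0 \<and>
     (\<forall>W. subspace class_ring W (module_vec TYPE(complex) n) \<and>
          (\<forall>g\<in>carrier G. \<forall>w\<in>W. \<rho> g *\<^sub>v w \<in> W)
        \<longrightarrow> W = {0\<^sub>v n} \<or> W = carrier_vec n)"

definition mat_trace :: "complex mat \<Rightarrow> complex" where
  "mat_trace A = (\<Sum>i<dim_row A. A $$ (i, i))"

text \<open>
  Characters are restricted to the carrier (\<open>undefined\<close> elsewhere), so that equality of
  characters as HOL functions is equality as functions on the group.
\<close>

definition character_of ::
    "('a, 'b) monoid_scheme \<Rightarrow> ('a \<Rightarrow> complex mat) \<Rightarrow> 'a \<Rightarrow> complex" where
  "character_of G \<rho> = (\<lambda>g\<in>carrier G. mat_trace (\<rho> g))"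

definition Irr :: "('a, 'b) monoid_scheme \<Rightarrow> ('a \<Rightarrow> complex) set" where
  "Irr G = {character_of G \<rho> | n \<rho>. irreducible_representation G n \<rho>}"

definition linear_characters :: "('a, 'b) monoid_scheme \<Rightarrow> ('a \<Rightarrow> complex) set" where
  "linear_characters G = {character_of G \<rho> | \<rho>. representation G 1 \<rho>}"

definition character_kernel :: "('a, 'b) monoid_scheme \<Rightarrow> ('a \<Rightarrow> complex) \<Rightarrow> 'a set" where
  "character_kernel G \<chi> = {g \<in> carrier G. \<chi> g = \<chi> \<one>\<^bsub>G\<^esub>}"

definition induced ::
    "('a, 'b) monoid_scheme \<Rightarrow> 'a set \<Rightarrow> ('a \<Rightarrow> complex) \<Rightarrow> 'a \<Rightarrow> complex" where
  "induced G H \<phi> = (\<lambda>g\<in>carrier G. (1 / of_nat (card H)) *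
     (\<Sum>x\<in>carrier G. if x \<otimes>\<^bsub>G\<^esub> g \<otimes>\<^bsub>G\<^esub> inv\<^bsub>G\<^esub> x \<in> H
                      then \<phi> (x \<otimes>\<^bsub>G\<^esub> g \<otimes>\<^bsub>G\<^esub> inv\<^bsub>G\<^esub> x) else 0))"

definition supercharacter ::
    "('a, 'b) monoid_scheme \<Rightarrow> ('a \<Rightarrow> complex) set \<Rightarrow> 'a \<Rightarrow> complex" where
  "supercharacter G X = (\<lambda>g\<in>carrier G. \<Sum>\<psi>\<in>X. \<psi> \<one>\<^bsub>G\<^esub> * \<psi> g)"

type_synonym 'a partition_pair = "('a \<Rightarrow> complex) set set \<times> 'a set set"

definition supercharacter_theory ::
    "('a, 'b) monoid_scheme \<Rightarrow> 'a partition_pair \<Rightarrow> bool" where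
  "supercharacter_theory G = (\<lambda>(\<X>, \<K>).
     partition_on (Irr G) \<X> \<and> partition_on (carrier G) \<K> \<and>
     {\<one>\<^bsub>G\<^esub>} \<in> \<K> \<and> card \<X> = card \<K> \<and>
     (\<forall>X\<in>\<X>. \<forall>K\<in>\<K>. \<forall>g\<in>K. \<forall>h\<in>K. supercharacter G X g = supercharacter G X h))"

definition quasi_monomial :: "('a, 'b) monoid_scheme \<Rightarrow> 'a partition_pair \<Rightarrow> bool" where
  "quasi_monomial G = (\<lambda>(\<X>, \<K>). \<forall>X\<in>\<X>.
     \<exists>(t::nat) (H :: nat \<Rightarrow> 'a set) (lam :: nat \<Rightarrow> 'a \<Rightarrow> complex) (d::nat).
       d > 0 \<and>
       (\<forall>i\<in>{1..t}. subgroup (H i) G \<and> lam i \<in> linear_characters (G\<lparr>carrier := H i\<rparr>)) \<and>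
       (\<forall>g\<in>carrier G. (\<Sum>i=1..t. induced G (H i) (lam i) g) = of_nat d * supercharacter G X g))"

definition C_normal :: "('a, 'b) monoid_scheme \<Rightarrow> 'a partition_pair \<Rightarrow> 'a set \<Rightarrow> bool" where
  "C_normal G = (\<lambda>(\<X>, \<K>) N. N \<lhd> G \<and> (\<exists>\<S>\<subseteq>\<K>. N = \<Union>\<S>))"

text \<open>
  The function on \<open>G/N\<close> taking the coset \<open>gN\<close> to \<open>\<chi> g\<close>; it is meaningful when \<open>\<chi>\<close> is
  constant on cosets of \<open>N\<close>, as is the case for a character with \<open>N\<close> in its kernel.
\<close>

definition deflate ::
    "('a, 'b) monoid_scheme \<Rightarrow> 'a set \<Rightarrow> ('a \<Rightarrow> complex) \<Rightarrow> 'a set \<Rightarrow> complex" where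
  "deflate G N \<chi> = (\<lambda>A\<in>carrier (G Mod N). the_elem (\<chi> ` A))"

text \<open>
  The elements of \<open>G Mod N\<close> are right cosets \<open>N #> g\<close>, which for normal \<open>N\<close> are the
  left cosets \<open>gN\<close>.
\<close>

definition quotient_theory ::
    "('a, 'b) monoid_scheme \<Rightarrow> 'a partition_pair \<Rightarrow> 'a set \<Rightarrow> 'a set partition_pair" where
  "quotient_theory G = (\<lambda>(\<X>, \<K>) N.
     ({deflate G N ` X | X. X \<in> \<X> \<and> (\<forall>\<chi>\<in>X. N \<subseteq> character_kernel G \<chi>)},
      {(\<lambda>g. N #>\<^bsub>G\<^esub> g) ` (K <#>\<^bsub>G\<^esub> N) | K. K \<in> \<K>}))"

end

theory Submission
  imports Defs "HOL-Algebra.Multiplicative_Group"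
begin

text \<open>
  If \<open>N\<close> lies in the kernel of every constituent of \<open>\<sigma>\<^sub>X\<close>, then \<open>\<sigma>\<^sub>X\<close> is constant on \<open>N\<close>. As an
  induced linear character takes its largest real part at the identity, the relation
  \<open>\<lambda>\<^sub>1\<^sup>G + \<dots> + \<lambda>\<^sub>t\<^sup>G = d \<sigma>\<^sub>X\<close>, evaluated on \<open>N\<close> and at the identity, forces every \<open>\<lambda>\<^sub>i\<^sup>G\<close> to be
  constant on \<open>N\<close>. This in turn forces \<open>N \<subseteq> H\<^sub>i\<close> and \<open>\<lambda>\<^sub>i = 1\<close> on \<open>N\<close>, so that each
  \<open>\<lambda>\<^sub>i\<close> descends to a linear character of \<open>H\<^sub>i/N\<close> and the relation descends to \<open>G/N\<close>.
\<close>

section \<open>Representations and linear characters\<close>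

lemma representationD:
  assumes "group G" and "representation G n \<rho>"
  shows "g \<in> carrier G \<Longrightarrow> \<rho> g \<in> carrier_mat n n"
    and "g \<in> carrier G \<Longrightarrow> h \<in> carrier G \<Longrightarrow> \<rho> (g \<otimes>\<^bsub>G\<^esub> h) = \<rho> g * \<rho> h"
    and "\<rho> \<one>\<^bsub>G\<^esub> = 1\<^sub>m n"
proof -
  let ?R = "ring_mat TYPE(complex) n ()"
  interpret R: ring ?R by (rule ring_mat)
  have h: "\<rho> \<in> hom G (units_of ?R)" using assms(2) by (simp add: representation_def)
  interpret \<rho>: group_hom G "units_of ?R" \<rho>
    using assms(1) h by (auto simp: group_hom_def group_hom_axioms_def R.units_group)
  show "\<rho> g \<in> carrier_mat n n" if "g \<in> carrier G"
    using \<rho>.hom_closed[OF that] R.Units_closed by (simp add: units_of_carrier ring_mat_simps)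
  show "\<rho> (g \<otimes>\<^bsub>G\<^esub> h) = \<rho> g * \<rho> h" if "g \<in> carrier G" "h \<in> carrier G"
    using \<rho>.hom_mult[OF that] by (simp add: units_of_mult ring_mat_simps)
  show "\<rho> \<one>\<^bsub>G\<^esub> = 1\<^sub>m n" using \<rho>.hom_one by (simp add: units_of_one ring_mat_simps)
qed

text \<open>A 1 by 1 matrix is determined by its trace and multiplies like a scalar, so linear
  characters can be handled without matrices from here on. The \<open>extensional\<close> clause
  reflects the restriction to the carrier in \<open>character_of\<close>.\<close>

lemma linear_characters_iff:
  assumes "group K"
  shows "\<chi> \<in> linear_characters K \<longleftrightarrow> \<chi> \<in> extensional (carrier K) \<and> \<chi> \<one>\<^bsub>K\<^esub> = 1 \<and>
    (\<forall>x\<in>carrier K. \<forall>y\<in>carrier K. \<chi> (x \<otimes>\<^bsub>K\<^esub> y) = \<chi> x * \<chi> y)"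
proof (intro iffI conjI ballI)
  interpret group K by fact
  assume "\<chi> \<in> linear_characters K"
  then obtain \<rho> where \<rho>: "representation K 1 \<rho>" and \<chi>: "\<chi> = character_of K \<rho>"
    by (auto simp: linear_characters_def)
  note r = representationD[OF assms \<rho>]
  have val: "\<chi> x = \<rho> x $$ (0,0)" if "x \<in> carrier K" for x
    using r(1)[OF that] that by (auto simp: \<chi> character_of_def mat_trace_def)
  show "\<chi> \<in> extensional (carrier K)" by (simp add: \<chi> character_of_def)
  show "\<chi> \<one>\<^bsub>K\<^esub> = 1" using val r(3) by simp
  fix x y assume x: "x \<in> carrier K" and y: "y \<in> carrier K"
  show "\<chi> (x \<otimes>\<^bsub>K\<^esub> y) = \<chi> x * \<chi> y"
    using r(1)[OF x] r(1)[OF y] x y by (simp add: val r(2) scalar_prod_def)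
next
  interpret group K by fact
  let ?R = "ring_mat TYPE(complex) 1 ()"
  interpret R: ring ?R by (rule ring_mat)
  assume "\<chi> \<in> extensional (carrier K) \<and> \<chi> \<one>\<^bsub>K\<^esub> = 1 \<and>
    (\<forall>x\<in>carrier K. \<forall>y\<in>carrier K. \<chi> (x \<otimes>\<^bsub>K\<^esub> y) = \<chi> x * \<chi> y)"
  then have ext: "\<chi> \<in> extensional (carrier K)" and one: "\<chi> \<one>\<^bsub>K\<^esub> = 1"
    and mult: "\<And>x y. x \<in> carrier K \<Longrightarrow> y \<in> carrier K \<Longrightarrow> \<chi> (x \<otimes>\<^bsub>K\<^esub> y) = \<chi> x * \<chi> y" by auto
  define \<rho> where "\<rho> x = mat 1 1 (\<lambda>_. \<chi> x)" for x
  have prod: "\<rho> x * \<rho> y = \<rho> (x \<otimes>\<^bsub>K\<^esub> y)" if "x \<in> carrier K" "y \<in> carrier K" for x y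
    by (rule eq_matI) (auto simp: \<rho>_def scalar_prod_def mult that)
  have id: "\<rho> \<one>\<^bsub>K\<^esub> = 1\<^sub>m 1" by (rule eq_matI) (auto simp: \<rho>_def one)
  have unit: "\<rho> x \<in> Units ?R" if "x \<in> carrier K" for x
    unfolding Units_def ring_mat_simps using that prod[of x "inv\<^bsub>K\<^esub> x"] prod[of "inv\<^bsub>K\<^esub> x" x] id
    by (auto simp: \<rho>_def intro!: bexI[of _ "\<rho> (inv\<^bsub>K\<^esub> x)"])
  have "representation K 1 \<rho>"
    using unit by (auto simp: representation_def hom_def units_of_carrier units_of_mult ring_mat_simps prod
        simp del: One_nat_def)
  moreover have "\<chi> = character_of K \<rho>"
    using ext by (auto simp: character_of_def mat_trace_def \<rho>_def extensional_def fun_eq_iff)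
  ultimately show "\<chi> \<in> linear_characters K" by (auto simp: linear_characters_def)
qed

text \<open>By Lagrange every element has a power equal to the identity with exponent the group
  order, so the values are roots of unity.\<close>

lemma norm_linear_character:
  assumes "group K" and "finite (carrier K)" and "\<chi> \<in> linear_characters K" and x: "x \<in> carrier K"
  shows "norm (\<chi> x) = 1"
proof -
  interpret group K by fact
  note \<chi> = assms(3)[unfolded linear_characters_iff[OF assms(1)]]
  have "\<chi> (x [^]\<^bsub>K\<^esub> k) = \<chi> x ^ k" for k :: nat
    using \<chi> x by (induction k) auto
  then have "\<chi> x ^ Coset.order K = 1" using pow_order_eq_1[OF x] \<chi> by metis
  then have "norm (\<chi> x) ^ Coset.order K = 1 ^ Coset.order K" by (metis norm_power norm_one power_one)
  moreover have "Coset.order K > 0" using assms(2) order_gt_0_iff_finite by blast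
  ultimately show ?thesis by (metis norm_ge_zero power_eq_imp_eq_base zero_le_one)
qed

section \<open>Irreducible characters with \<open>N\<close> in their kernel, and their
  deflation\<close>

text \<open>
  The vectors fixed by \<open>N\<close> form an invariant subspace, since \<open>N\<close> is normal; if it were zero, then
  the columns of \<open>\<Sum>m\<in>N. \<rho> m\<close> would vanish, although the trace of this matrix is \<open>n * card N\<close>.
\<close>
lemma irreducible_representation_trivial_on_kernel:
  assumes "N \<lhd> G" and fin: "finite (carrier G)" and irr: "irreducible_representation G n \<rho>"
    and ker: "N \<subseteq> character_kernel G (character_of G \<rho>)" and m: "m \<in> N"
  shows "\<rho> m = 1\<^sub>m n"
proof -
  interpret normal N G by fact
  note rep = irr[unfolded irreducible_representation_def, THEN conjunct1]
  note r = representationD[OF is_group rep]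
  have n: "n > 0" using irr by (simp add: irreducible_representation_def)
  have finN: "finite N" using fin subset finite_subset by blast
  define W where "W = {v \<in> carrier_vec n. \<forall>k\<in>N. \<rho> k *\<^sub>v v = v}"
  have "VectorSpace.subspace class_ring W (module_vec TYPE(complex) n)"
  proof -
    interpret V: vec_space "TYPE(complex)" n .
    have "LinearCombinations.submodule class_ring W (module_vec TYPE(complex) n)"
    proof (unfold_locales, goal_cases)
      case 1 show ?case by (auto simp: W_def module_vec_simps)
    next
      case (2 v w) then show ?case
        using r(1) mem_carrier by (auto simp: W_def module_vec_simps mult_add_distrib_mat_vec[of _ n n])
    next
      case 3
      have "A *\<^sub>v 0\<^sub>v n = 0\<^sub>v n" if "A \<in> carrier_mat n n" for A :: "complex mat"
        using that by (intro eq_vecI) auto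
      then show ?case using r(1) mem_carrier by (simp add: W_def module_vec_simps)
    next
      case (4 c v) then show ?case
        using r(1) mem_carrier by (auto simp: W_def module_vec_simps mult_mat_vec[of _ n n])
    qed
    then show ?thesis using V.vectorspace_axioms by (simp add: VectorSpace.subspace_def)
  qed
  moreover have "\<rho> g *\<^sub>v w \<in> W" if g: "g \<in> carrier G" and w: "w \<in> W" for g w
  proof -
    have wc: "w \<in> carrier_vec n" using w by (simp add: W_def)
    have "\<rho> k *\<^sub>v (\<rho> g *\<^sub>v w) = \<rho> g *\<^sub>v w" if k: "k \<in> N" for k
    proof -
      \<comment> \<open>Normality enters here: moving \<open>k\<close> past \<open>g\<close>
        replaces it by a conjugate that still lies in \<open>N\<close> and therefore fixes
        \<open>w\<close>.\<close>
      define k' where "k' = inv\<^bsub>G\<^esub> g \<otimes>\<^bsub>G\<^esub> k \<otimes>\<^bsub>G\<^esub> g"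
      have k': "k' \<in> N" unfolding k'_def using inv_op_closed1 g k by simp
      have eq: "k \<otimes>\<^bsub>G\<^esub> g = g \<otimes>\<^bsub>G\<^esub> k'" using g k mem_carrier by (simp add: k'_def m_assoc[symmetric])
      have "\<rho> k *\<^sub>v (\<rho> g *\<^sub>v w) = \<rho> (k \<otimes>\<^bsub>G\<^esub> g) *\<^sub>v w"
        using r g k mem_carrier wc by (simp add: assoc_mult_mat_vec[of _ n n _ n])
      also have "\<dots> = \<rho> g *\<^sub>v (\<rho> k' *\<^sub>v w)"
        using r g k' mem_carrier wc by (simp add: eq assoc_mult_mat_vec[of _ n n _ n])
      also have "\<rho> k' *\<^sub>v w = w" using w k' by (simp add: W_def)
      finally show ?thesis .
    qed
    moreover have "\<rho> g *\<^sub>v w \<in> carrier_vec n" using r(1)[OF g] wc by auto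
    ultimately show ?thesis by (simp add: W_def)
  qed
  ultimately consider "W = {0\<^sub>v n}" | "W = carrier_vec n"
    using irr unfolding irreducible_representation_def by blast
  then show ?thesis
  proof cases
    case 1
    have idx: "(\<Sum>l<n. \<rho> k $$ (i,l) * \<rho> k' $$ (l,j)) = \<rho> (k \<otimes>\<^bsub>G\<^esub> k') $$ (i,j)"
      if "k \<in> N" "k' \<in> N" "i < n" "j < n" for k k' i j
      using that r(1)[OF mem_carrier, of k] r(1)[OF mem_carrier, of k'] r(2) mem_carrier
      by (simp add: scalar_prod_def lessThan_atLeast0)
    have zero: "(\<Sum>k\<in>N. \<rho> k $$ (j,j)) = 0" if j: "j < n" for j
    proof -
      \<comment> \<open>This is column \<open>j\<close> of the sum of \<open>\<rho> k\<close> over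
        \<open>N\<close>. Left multiplication by an element of \<open>N\<close> only permutes the
        summands, so \<open>v\<close> lies in \<open>W\<close> and is zero.\<close>
      define v where "v = vec n (\<lambda>i. \<Sum>k\<in>N. \<rho> k $$ (i,j))"
      have "\<rho> k *\<^sub>v v = v" if k: "k \<in> N" for k
      proof (rule eq_vecI)
        have rk: "\<rho> k \<in> carrier_mat n n" using r(1) k mem_carrier by blast
        then show "dim_vec (\<rho> k *\<^sub>v v) = dim_vec v" by (simp add: v_def)
        fix i assume "i < dim_vec v"
        then have i: "i < n" by (simp add: v_def)
        have "(\<rho> k *\<^sub>v v) $ i = (\<Sum>l<n. \<rho> k $$ (i,l) * (\<Sum>k'\<in>N. \<rho> k' $$ (l,j)))"
          using rk i by (simp add: v_def scalar_prod_def lessThan_atLeast0)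
        also have "\<dots> = (\<Sum>k'\<in>N. \<Sum>l<n. \<rho> k $$ (i,l) * \<rho> k' $$ (l,j))"
          unfolding sum_distrib_left by (rule sum.swap)
        also have "\<dots> = (\<Sum>k'\<in>N. \<rho> (k \<otimes>\<^bsub>G\<^esub> k') $$ (i,j))" using idx k i j by simp
        also have "\<dots> = (\<Sum>k'\<in>N. \<rho> k' $$ (i,j))"
          by (rule sum.reindex_bij_witness[of _ "\<lambda>x. inv\<^bsub>G\<^esub> k \<otimes>\<^bsub>G\<^esub> x" "\<lambda>x. k \<otimes>\<^bsub>G\<^esub> x"])
             (use k mem_carrier in \<open>auto simp: m_assoc[symmetric]\<close>)
        finally show "(\<rho> k *\<^sub>v v) $ i = v $ i" using i by (simp add: v_def)
      qed
      then have "v \<in> W" by (auto simp: W_def v_def)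
      then have "v $ j = 0" using 1 j by auto
      then show ?thesis using j by (simp add: v_def)
    qed
    have "(\<Sum>k\<in>N. mat_trace (\<rho> k)) = (\<Sum>k\<in>N. \<Sum>j<n. \<rho> k $$ (j,j))"
      using carrier_matD(1)[OF r(1)[OF mem_carrier]] by (simp add: mat_trace_def)
    also have "\<dots> = (\<Sum>j<n. \<Sum>k\<in>N. \<rho> k $$ (j,j))" by (rule sum.swap)
    also have "\<dots> = 0" using zero by simp
    finally have "(\<Sum>k\<in>N. mat_trace (\<rho> k)) = 0" .
    moreover have "mat_trace (\<rho> k) = of_nat n" if "k \<in> N" for k
    proof -
      have "mat_trace (\<rho> k) = mat_trace (\<rho> \<one>\<^bsub>G\<^esub>)"
        using subsetD[OF ker that] mem_carrier[OF that] by (simp add: character_kernel_def character_of_def)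
      then show ?thesis by (simp add: r(3) mat_trace_def)
    qed
    then have "(\<Sum>k\<in>N. mat_trace (\<rho> k)) = (\<Sum>k\<in>N. of_nat n)" by (rule sum.cong[OF refl])
    ultimately have "card N = 0" using n by simp
    then show ?thesis using finN m by auto
  next
    case 2
    \<comment> \<open>All vectors are fixed by \<open>N\<close>, in particular the unit vectors,
      whose images are the columns of \<open>\<rho> m\<close>.\<close>
    show ?thesis
    proof (rule eq_matI)
      have rm: "\<rho> m \<in> carrier_mat n n" using r(1) m mem_carrier by blast
      then show "dim_row (\<rho> m) = dim_row (1\<^sub>m n)" "dim_col (\<rho> m) = dim_col (1\<^sub>m n)" by auto
      fix i j assume "i < dim_row (1\<^sub>m n :: complex mat)" "j < dim_col (1\<^sub>m n :: complex mat)"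
      then have ij: "i < n" "j < n" by auto
      have "unit_vec n j \<in> W" using 2 by simp
      then have "\<rho> m *\<^sub>v unit_vec n j = unit_vec n j" using m by (simp add: W_def)
      moreover have "(\<rho> m *\<^sub>v unit_vec n j) $ i = \<rho> m $$ (i,j)" using rm ij by simp
      ultimately show "\<rho> m $$ (i,j) = 1\<^sub>m n $$ (i,j)" using ij by (simp add: unit_vec_def)
    qed
  qed
qed

lemma Irr_constant_on_coset:
  assumes "N \<lhd> G" and "finite (carrier G)" and "\<chi> \<in> Irr G" and "N \<subseteq> character_kernel G \<chi>"
    and m: "m \<in> N" and g: "g \<in> carrier G"
  shows "\<chi> (m \<otimes>\<^bsub>G\<^esub> g) = \<chi> g"
proof -
  interpret normal N G by fact
  obtain n \<rho> where \<rho>: "irreducible_representation G n \<rho>" and \<chi>: "\<chi> = character_of G \<rho>"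
    using assms(3) by (auto simp: Irr_def)
  note r = representationD[OF is_group \<rho>[unfolded irreducible_representation_def, THEN conjunct1]]
  have "\<rho> m = 1\<^sub>m n"
    using irreducible_representation_trivial_on_kernel[OF assms(1,2) \<rho> _ m] assms(4) \<chi> by simp
  then have "\<rho> (m \<otimes>\<^bsub>G\<^esub> g) = \<rho> g" using r(1)[OF g] r(2) m g mem_carrier by simp
  then show ?thesis using m g mem_carrier by (simp add: \<chi> character_of_def)
qed

text \<open>Invariance under \<open>N\<close> makes the image of the coset a singleton. This serves
  both the deflated irreducible characters and the descended linear characters.\<close>

lemma the_elem_image_r_coset:
  assumes "group G" and "subgroup N G" and "g \<in> carrier G"
    and "\<And>m. m \<in> N \<Longrightarrow> f (m \<otimes>\<^bsub>G\<^esub> g) = f g"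
  shows "the_elem (f ` (N #>\<^bsub>G\<^esub> g)) = f g"
proof -
  have "f ` (N #>\<^bsub>G\<^esub> g) = {f g}"
    using assms(4) subgroup.one_closed[OF assms(2)] by (auto simp: r_coset_def image_iff)
  then show ?thesis by simp
qed

lemma deflate_r_coset:
  assumes "N \<lhd> G" and "finite (carrier G)" and "\<chi> \<in> Irr G" and "N \<subseteq> character_kernel G \<chi>"
    and g: "g \<in> carrier G"
  shows "deflate G N \<chi> (N #>\<^bsub>G\<^esub> g) = \<chi> g"
proof -
  interpret normal N G by fact
  have "N #>\<^bsub>G\<^esub> g \<in> carrier (G Mod N)" using g by (simp add: carrier_FactGroup)
  then show ?thesis
    using the_elem_image_r_coset[OF is_group subgroup_axioms g Irr_constant_on_coset[OF assms(1-4) _ g]]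
    by (simp add: deflate_def)
qed

text \<open>Deflation preserves values, hence is injective on \<open>X\<close>; the sum over the
  image set therefore merges no two constituents.\<close>

lemma supercharacter_deflate:
  assumes "N \<lhd> G" and "finite (carrier G)" and X: "X \<subseteq> Irr G"
    and ker: "\<And>\<chi>. \<chi> \<in> X \<Longrightarrow> N \<subseteq> character_kernel G \<chi>" and g: "g \<in> carrier G"
  shows "supercharacter (G Mod N) (deflate G N ` X) (N #>\<^bsub>G\<^esub> g) = supercharacter G X g"
proof -
  interpret normal N G by fact
  have val: "deflate G N \<chi> (N #>\<^bsub>G\<^esub> x) = \<chi> x" if "\<chi> \<in> X" "x \<in> carrier G" for \<chi> x
    using deflate_r_coset[OF assms(1,2) _ ker that(2)] that X by blast
  have "inj_on (deflate G N) X"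
  proof (rule inj_onI)
    fix \<chi> \<psi> assume a: "\<chi> \<in> X" "\<psi> \<in> X" "deflate G N \<chi> = deflate G N \<psi>"
    have "\<chi> \<in> extensional (carrier G)" "\<psi> \<in> extensional (carrier G)"
      using a X by (auto simp: Irr_def character_of_def)
    moreover have "\<chi> x = \<psi> x" if "x \<in> carrier G" for x using val a that by metis
    ultimately show "\<chi> = \<psi>" by (rule extensionalityI)
  qed
  \<comment> \<open>The identity of \<open>G Mod N\<close> is the set \<open>N\<close> itself, so
    degrees agree as well.\<close>
  moreover have "N = N #>\<^bsub>G\<^esub> \<one>\<^bsub>G\<^esub>" using coset_mult_one subset by simp
  then have "deflate G N \<chi> N = \<chi> \<one>\<^bsub>G\<^esub>" if "\<chi> \<in> X" for \<chi> using val[OF that one_closed] by simp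
  ultimately show ?thesis
    using g by (simp add: supercharacter_def carrier_FactGroup sum.reindex val)
qed

section \<open>Real parts of induced linear characters\<close>

lemma induced_one:
  assumes "group G" and "subgroup H G" and "finite (carrier G)"
    and "\<phi> \<in> linear_characters (G\<lparr>carrier := H\<rparr>)"
  shows "induced G H \<phi> \<one>\<^bsub>G\<^esub> = of_nat (card (carrier G)) / of_nat (card H)"
proof -
  interpret group G by fact
  have "\<phi> \<one>\<^bsub>G\<^esub> = 1"
    using assms(4) subgroup.subgroup_is_group[OF assms(2,1)] by (simp add: linear_characters_iff)
  then show ?thesis using subgroup.one_closed[OF assms(2)] by (simp add: induced_def)
qed

text \<open>Each summand of the induction formula is zero or of modulus 1, so its real part is at
  most 1, while at the identity every summand is 1. Equality of the totals forces equality in every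
  summand.\<close>

lemma Re_induced_le:
  assumes "group G" and "subgroup H G" and "finite (carrier G)"
    and \<phi>: "\<phi> \<in> linear_characters (G\<lparr>carrier := H\<rparr>)" and g: "g \<in> carrier G"
  shows "Re (induced G H \<phi> g) \<le> Re (induced G H \<phi> \<one>\<^bsub>G\<^esub>)"
    and "Re (induced G H \<phi> g) = Re (induced G H \<phi> \<one>\<^bsub>G\<^esub>) \<Longrightarrow> g \<in> H \<and> \<phi> g = 1"
proof -
  interpret group G by fact
  interpret H: subgroup H G by fact
  have finH: "finite H" using assms(3) H.subset finite_subset by blast
  then have cH: "real (card H) > 0" using H.one_closed by (metis card_gt_0_iff empty_iff of_nat_0_less_iff)
  have norm1: "norm (\<phi> h) = 1" if "h \<in> H" for h
    by (rule norm_linear_character[OF H.subgroup_is_group[OF assms(1)] _ \<phi>]) (simp_all add: finH that)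
  define f where "f x = (if x \<otimes>\<^bsub>G\<^esub> g \<otimes>\<^bsub>G\<^esub> inv\<^bsub>G\<^esub> x \<in> H then \<phi> (x \<otimes>\<^bsub>G\<^esub> g \<otimes>\<^bsub>G\<^esub> inv\<^bsub>G\<^esub> x) else 0)" for x
  have le: "Re (f x) \<le> 1" for x
    using norm1[of "x \<otimes>\<^bsub>G\<^esub> g \<otimes>\<^bsub>G\<^esub> inv\<^bsub>G\<^esub> x"] complex_Re_le_cmod[of "\<phi> (x \<otimes>\<^bsub>G\<^esub> g \<otimes>\<^bsub>G\<^esub> inv\<^bsub>G\<^esub> x)"]
    by (auto simp: f_def)
  have "induced G H \<phi> g = (\<Sum>x\<in>carrier G. f x) / of_nat (card H)"
    using g by (simp add: induced_def f_def)
  then have Re_g: "Re (induced G H \<phi> g) = (\<Sum>x\<in>carrier G. Re (f x)) / card H"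
    by (simp add: Re_divide_of_nat)
  have Re_one: "Re (induced G H \<phi> \<one>\<^bsub>G\<^esub>) = (\<Sum>x\<in>carrier G. 1) / card H"
    using induced_one[OF assms(1-4)] by (simp add: Re_divide_of_nat)
  show "Re (induced G H \<phi> g) \<le> Re (induced G H \<phi> \<one>\<^bsub>G\<^esub>)"
    unfolding Re_g Re_one using le by (intro divide_right_mono sum_mono) auto
  assume "Re (induced G H \<phi> g) = Re (induced G H \<phi> \<one>\<^bsub>G\<^esub>)"
  then have "(\<Sum>x\<in>carrier G. Re (f x)) = (\<Sum>x\<in>carrier G. 1)"
    unfolding Re_g Re_one using cH by simp
  \<comment> \<open>The summand at the identity involves \<open>g\<close> itself instead of a proper
    conjugate. Its real part 1 excludes the default value 0, so \<open>g\<close> lies in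
    \<open>H\<close>.\<close>
  then have "Re (f \<one>\<^bsub>G\<^esub>) = 1" by (rule sum_mono_inv) (use le assms(3) in auto)
  then have gH: "g \<in> H" and Re1: "Re (\<phi> g) = 1" using g by (auto simp: f_def split: if_splits)
  \<comment> \<open>The only point of the unit circle with real part 1 is 1.\<close>
  have "(Re (\<phi> g))\<^sup>2 + (Im (\<phi> g))\<^sup>2 = 1" using norm1[OF gH] cmod_power2[of "\<phi> g"] by simp
  then show "g \<in> H \<and> \<phi> g = 1" using gH Re1 by (simp add: complex_eq_iff)
qed

section \<open>Cosets, and descent of linear characters to the quotient\<close>

text \<open>The fibre of the projection over a coset is that coset, and all cosets have the size of
  the normal subgroup, here called \<open>H\<close> as in the locale.\<close>

lemma (in normal) sum_r_coset:
  assumes "finite (carrier G)"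
  shows "(\<Sum>x\<in>carrier G. f (H #> x)) = of_nat (card H) * (\<Sum>A\<in>carrier (G Mod H). f A :: 'c::comm_semiring_1)"
proof -
  have fib: "{x \<in> carrier G. H #> x = A} = A" if A: "A \<in> carrier (G Mod H)" for A
  proof -
    obtain g where g: "g \<in> carrier G" "A = H #> g" using A by (auto simp: carrier_FactGroup)
    show ?thesis
      unfolding g(2) using repr_independence[OF _ g(1) subgroup_axioms] rcos_self[OF _ subgroup_axioms]
        r_coset_subset_G[OF subset g(1)] by blast
  qed
  have "(\<Sum>x\<in>carrier G. f (H #> x)) = (\<Sum>A\<in>carrier (G Mod H). \<Sum>x\<in>{x \<in> carrier G. H #> x = A}. f (H #> x))"
    using assms by (subst sum.image_gen[where g = "\<lambda>x. H #> x"]) (auto simp: carrier_FactGroup)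
  also have "\<dots> = (\<Sum>A\<in>carrier (G Mod H). of_nat (card H) * f A)"
  proof (rule sum.cong[OF refl])
    fix A assume A: "A \<in> carrier (G Mod H)"
    have "(\<Sum>x\<in>{x \<in> carrier G. H #> x = A}. f (H #> x)) = (\<Sum>x\<in>{x \<in> carrier G. H #> x = A}. f A)"
      by (rule sum.cong) auto
    also have "\<dots> = of_nat (card A) * f A" by (simp add: fib[OF A])
    also have "card A = card H" using card_rcosets_equal[OF _ subset, of A] A by (simp add: FactGroup_def)
    finally show "(\<Sum>x\<in>{x \<in> carrier G. H #> x = A}. f (H #> x)) = of_nat (card H) * f A" .
  qed
  finally show ?thesis by (simp add: sum_distrib_left)
qed

text \<open>A subgroup containing \<open>H\<close> is a union of cosets of \<open>H\<close>. This
  transfers the membership test in the induction formula between group and quotient.\<close>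

lemma (in normal) r_coset_mem_image_iff:
  assumes "subgroup K G" and "H \<subseteq> K" and "x \<in> carrier G"
  shows "H #> x \<in> (\<lambda>k. H #> k) ` K \<longleftrightarrow> x \<in> K"
proof
  assume "H #> x \<in> (\<lambda>k. H #> k) ` K"
  then obtain k where k: "k \<in> K" "H #> x = H #> k" by auto
  then have "x \<in> H #> k" using rcos_self[OF assms(3) subgroup_axioms] by simp
  then show "x \<in> K" using k(1) assms(2) subgroup.m_closed[OF assms(1)] by (auto simp: r_coset_def)
qed auto

lemma (in normal) subgroup_image_r_coset:
  assumes "subgroup K G"
  shows "subgroup ((\<lambda>k. H #> k) ` K) (G Mod H)"
proof -
  interpret K: subgroup K G by fact
  interpret Q: group "G Mod H" by (rule factorgroup_is_group)
  show ?thesis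
  proof (rule Q.subgroupI)
    show "(\<lambda>k. H #> k) ` K \<subseteq> carrier (G Mod H)" using K.subset by (auto simp: carrier_FactGroup)
    show "(\<lambda>k. H #> k) ` K \<noteq> {}" using K.one_closed by blast
    fix A assume A: "A \<in> (\<lambda>k. H #> k) ` K"
    then obtain k where k: "k \<in> K" "A = H #> k" by blast
    then have "inv\<^bsub>G Mod H\<^esub> A = H #> inv k"
      using inv_FactGroup[of A] K.mem_carrier by (simp add: carrier_FactGroup rcos_inv)
    then show "inv\<^bsub>G Mod H\<^esub> A \<in> (\<lambda>k. H #> k) ` K" using k by simp
    fix B assume B: "B \<in> (\<lambda>k. H #> k) ` K"
    then obtain l where l: "l \<in> K" "B = H #> l" by blast
    show "A \<otimes>\<^bsub>G Mod H\<^esub> B \<in> (\<lambda>k. H #> k) ` K"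
      using k l K.mem_carrier by (simp add: rcos_sum)
  qed
qed

text \<open>Since \<open>\<phi>\<close> is multiplicative and trivial on \<open>N\<close>, it is
  constant on the cosets inside \<open>H\<close>. In the induction formula the sum over
  \<open>G\<close> is \<open>card N\<close> times the sum over the quotient, and this factor cancels
  against \<open>card H = card N * card H'\<close>.\<close>

lemma linear_character_descends:
  assumes "N \<lhd> G" and fin: "finite (carrier G)" and H: "subgroup H G" and NH: "N \<subseteq> H"
    and \<phi>: "\<phi> \<in> linear_characters (G\<lparr>carrier := H\<rparr>)" and triv: "\<And>m. m \<in> N \<Longrightarrow> \<phi> m = 1"
  defines "H' \<equiv> (\<lambda>h. N #>\<^bsub>G\<^esub> h) ` H"
  defines "\<phi>' \<equiv> (\<lambda>A\<in>H'. the_elem (\<phi> ` A))"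
  shows "subgroup H' (G Mod N)"
    and "\<phi>' \<in> linear_characters ((G Mod N)\<lparr>carrier := H'\<rparr>)"
    and "g \<in> carrier G \<Longrightarrow> induced (G Mod N) H' \<phi>' (N #>\<^bsub>G\<^esub> g) = induced G H \<phi> g"
proof -
  interpret normal N G by fact
  interpret H: subgroup H G by fact
  interpret Q: group "G Mod N" by (rule factorgroup_is_group)
  have \<phi>_mult: "\<phi> (x \<otimes>\<^bsub>G\<^esub> y) = \<phi> x * \<phi> y" if "x \<in> H" "y \<in> H" for x y
    using \<phi> that by (simp add: linear_characters_iff[OF H.subgroup_is_group[OF is_group]])
  have val: "\<phi>' (N #>\<^bsub>G\<^esub> h) = \<phi> h" if "h \<in> H" for h
  proof -
    have "the_elem (\<phi> ` (N #>\<^bsub>G\<^esub> h)) = \<phi> h"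
      using that NH by (intro the_elem_image_r_coset[OF is_group subgroup_axioms])
        (auto simp: \<phi>_mult triv)
    then show ?thesis using that by (simp add: \<phi>'_def H'_def)
  qed
  show sub: "subgroup H' (G Mod N)" unfolding H'_def using H by (rule subgroup_image_r_coset)
  show "\<phi>' \<in> linear_characters ((G Mod N)\<lparr>carrier := H'\<rparr>)"
    unfolding linear_characters_iff[OF subgroup.subgroup_is_group[OF sub Q.is_group]]
  proof (intro conjI ballI)
    show "\<phi>' \<in> extensional (carrier ((G Mod N)\<lparr>carrier := H'\<rparr>))" by (simp add: \<phi>'_def)
    have "N = N #>\<^bsub>G\<^esub> \<one>\<^bsub>G\<^esub>" using coset_mult_one subset by simp
    then show "\<phi>' \<one>\<^bsub>(G Mod N)\<lparr>carrier := H'\<rparr>\<^esub> = 1" using val[OF H.one_closed] triv by simp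
    fix A B assume "A \<in> carrier ((G Mod N)\<lparr>carrier := H'\<rparr>)" "B \<in> carrier ((G Mod N)\<lparr>carrier := H'\<rparr>)"
    then obtain a b where "a \<in> H" "A = N #>\<^bsub>G\<^esub> a" "b \<in> H" "B = N #>\<^bsub>G\<^esub> b" by (auto simp: H'_def)
    then show "\<phi>' (A \<otimes>\<^bsub>(G Mod N)\<lparr>carrier := H'\<rparr>\<^esub> B) = \<phi>' A * \<phi>' B"
      by (simp add: rcos_sum val \<phi>_mult)
  qed
  assume g: "g \<in> carrier G"
  have cardN: "card N > 0"
    using finite_subset[OF subset fin] subgroup.one_closed[OF subgroup_axioms] by (metis card_gt_0_iff empty_iff)
  \<comment> \<open>Counted by summing the indicator of \<open>H'\<close> over cosets with
    \<open>sum_r_coset\<close>.\<close>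
  have cardH: "card H = card N * card H'"
  proof -
    have "(\<Sum>x\<in>carrier G. if N #>\<^bsub>G\<^esub> x \<in> H' then 1 else 0) =
        card N * (\<Sum>A\<in>carrier (G Mod N). if A \<in> H' then 1 else 0)"
      using sum_r_coset[OF fin, of "\<lambda>A. if A \<in> H' then 1 else (0::nat)"] by simp
    moreover have "(\<Sum>x\<in>carrier G. if N #>\<^bsub>G\<^esub> x \<in> H' then 1 else (0::nat)) = card H"
    proof -
      have "(\<Sum>x\<in>carrier G. if N #>\<^bsub>G\<^esub> x \<in> H' then 1 else (0::nat)) = (\<Sum>x\<in>carrier G. if x \<in> H then 1 else 0)"
        using r_coset_mem_image_iff[OF H NH] by (intro sum.cong) (auto simp: H'_def)
      also have "\<dots> = card H"
        using fin H.subset by (simp add: sum.If_cases Int_absorb1)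
      finally show ?thesis .
    qed
    moreover have "(\<Sum>A\<in>carrier (G Mod N). if A \<in> H' then 1 else (0::nat)) = card H'"
      using fin subgroup.subset[OF sub] by (simp add: carrier_FactGroup sum.If_cases Int_absorb1)
    ultimately show ?thesis by simp
  qed
  \<comment> \<open>\<open>F\<close> is the summand of the induction formula in
    \<open>G Mod N\<close>; composed with the projection it becomes the summand of the formula in
    \<open>G\<close>.\<close>
  define F where "F A = (let B = A \<otimes>\<^bsub>G Mod N\<^esub> (N #>\<^bsub>G\<^esub> g) \<otimes>\<^bsub>G Mod N\<^esub> inv\<^bsub>G Mod N\<^esub> A in
    if B \<in> H' then \<phi>' B else 0)" for A
  have F: "F (N #>\<^bsub>G\<^esub> x) = (let y = x \<otimes>\<^bsub>G\<^esub> g \<otimes>\<^bsub>G\<^esub> inv\<^bsub>G\<^esub> x in if y \<in> H then \<phi> y else 0)" if x: "x \<in> carrier G" for x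
  proof -
    have "inv\<^bsub>G Mod N\<^esub> (N #>\<^bsub>G\<^esub> x) = N #>\<^bsub>G\<^esub> inv\<^bsub>G\<^esub> x"
      using x inv_FactGroup[of "N #>\<^bsub>G\<^esub> x"] by (simp add: carrier_FactGroup rcos_inv)
    then have "(N #>\<^bsub>G\<^esub> x) \<otimes>\<^bsub>G Mod N\<^esub> (N #>\<^bsub>G\<^esub> g) \<otimes>\<^bsub>G Mod N\<^esub> inv\<^bsub>G Mod N\<^esub> (N #>\<^bsub>G\<^esub> x)
        = N #>\<^bsub>G\<^esub> (x \<otimes>\<^bsub>G\<^esub> g \<otimes>\<^bsub>G\<^esub> inv\<^bsub>G\<^esub> x)"
      using x g by (simp add: rcos_sum)
    then show ?thesis
      using r_coset_mem_image_iff[OF H NH] x g val by (simp add: F_def Let_def H'_def)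
  qed
  have "induced G H \<phi> g = (\<Sum>x\<in>carrier G. F (N #>\<^bsub>G\<^esub> x)) / of_nat (card H)"
    using g by (simp add: induced_def F Let_def)
  also have "\<dots> = (\<Sum>A\<in>carrier (G Mod N). F A) / of_nat (card H')"
    using cardN by (simp add: sum_r_coset[OF fin] cardH)
  also have "\<dots> = induced (G Mod N) H' \<phi>' (N #>\<^bsub>G\<^esub> g)"
    using g by (simp add: induced_def F_def Let_def carrier_FactGroup cong: if_cong)
  finally show "induced (G Mod N) H' \<phi>' (N #>\<^bsub>G\<^esub> g) = induced G H \<phi> g" by simp
qed

section \<open>Passing the quasi-monomial relation to the quotient\<close>

text \<open>Real parts are bounded termwise by their values at the identity, so no term can fall
  short when the sums agree; the equality case of \<open>Re_induced_le\<close> then applies to each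
  term.\<close>

lemma kernel_of_induced_sum:
  assumes "N \<lhd> G" and fin: "finite (carrier G)" and "finite I"
    and H: "\<And>i. i \<in> I \<Longrightarrow> subgroup (H i) G"
    and lam: "\<And>i. i \<in> I \<Longrightarrow> lam i \<in> linear_characters (G\<lparr>carrier := H i\<rparr>)"
    and m: "m \<in> N"
    and eq: "(\<Sum>i\<in>I. induced G (H i) (lam i) m) = (\<Sum>i\<in>I. induced G (H i) (lam i) \<one>\<^bsub>G\<^esub>)"
    and i: "i \<in> I"
  shows "m \<in> H i \<and> lam i m = 1"
proof -
  interpret normal N G by fact
  have mG: "m \<in> carrier G" using m mem_carrier by blast
  have "(\<Sum>i\<in>I. Re (induced G (H i) (lam i) m)) = (\<Sum>i\<in>I. Re (induced G (H i) (lam i) \<one>\<^bsub>G\<^esub>))"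
    using arg_cong[OF eq, of Re] by simp
  then have "Re (induced G (H i) (lam i) m) = Re (induced G (H i) (lam i) \<one>\<^bsub>G\<^esub>)"
    by (rule sum_mono_inv) (use Re_induced_le(1)[OF is_group H fin lam mG] i \<open>finite I\<close> in auto)
  then show ?thesis using Re_induced_le(2)[OF is_group H fin lam mG] i by blast
qed

theorem theorem2p6:
  fixes G :: "('a, 'b) monoid_scheme" and C :: "'a partition_pair" and N :: "'a set"
  assumes "group G" and "finite (carrier G)"
    and "supercharacter_theory G C"
    and "C_normal G C N"
    and "quasi_monomial G C"
  shows "quasi_monomial (G Mod N) (quotient_theory G C N)"
proof -
  obtain \<X> \<K> where C: "C = (\<X>, \<K>)" by fastforce
  have N: "N \<lhd> G" using assms(4) by (simp add: C_normal_def C)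
  interpret normal N G by fact
  have "\<exists>(t::nat) H lam (d::nat). d > 0 \<and>
      (\<forall>i\<in>{1..t}. subgroup (H i) (G Mod N) \<and> lam i \<in> linear_characters ((G Mod N)\<lparr>carrier := H i\<rparr>)) \<and>
      (\<forall>A\<in>carrier (G Mod N). (\<Sum>i=1..t. induced (G Mod N) (H i) (lam i) A)
         = of_nat d * supercharacter (G Mod N) (deflate G N ` X) A)"
    if X: "X \<in> \<X>" and ker: "\<And>\<chi>. \<chi> \<in> X \<Longrightarrow> N \<subseteq> character_kernel G \<chi>" for X
  proof -
    obtain t :: nat and H lam and d :: nat where d: "d > 0"
      and H: "\<And>i. i \<in> {1..t} \<Longrightarrow> subgroup (H i) G"
      and lam: "\<And>i. i \<in> {1..t} \<Longrightarrow> lam i \<in> linear_characters (G\<lparr>carrier := H i\<rparr>)"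
      and sum: "\<And>g. g \<in> carrier G \<Longrightarrow>
        (\<Sum>i=1..t. induced G (H i) (lam i) g) = of_nat d * supercharacter G X g"
    proof -
      have "\<forall>X\<in>\<X>. \<exists>(t::nat) H lam (d::nat). d > 0 \<and>
          (\<forall>i\<in>{1..t}. subgroup (H i) G \<and> lam i \<in> linear_characters (G\<lparr>carrier := H i\<rparr>)) \<and>
          (\<forall>g\<in>carrier G. (\<Sum>i=1..t. induced G (H i) (lam i) g) = of_nat d * supercharacter G X g)"
        using assms(5) by (simp add: quasi_monomial_def C)
      from bspec[OF this X] show ?thesis by (elim exE conjE) (rule that, blast+)
    qed
    have XI: "X \<subseteq> Irr G"
      using assms(3) X by (auto simp: supercharacter_theory_def C partition_on_def)
    have const: "supercharacter G X m = supercharacter G X \<one>\<^bsub>G\<^esub>" if "m \<in> N" for m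
    proof -
      have eq: "\<psi> m = \<psi> \<one>\<^bsub>G\<^esub>" if "\<psi> \<in> X" for \<psi>
        using ker[OF that] \<open>m \<in> N\<close> by (auto simp: character_kernel_def)
      have "(\<Sum>\<psi>\<in>X. \<psi> \<one>\<^bsub>G\<^esub> * \<psi> m) = (\<Sum>\<psi>\<in>X. \<psi> \<one>\<^bsub>G\<^esub> * \<psi> \<one>\<^bsub>G\<^esub>)"
        by (intro sum.cong refl arg_cong2[where f = "(*)"] eq)
      then show ?thesis using mem_carrier[OF that] by (simp add: supercharacter_def)
    qed
    \<comment> \<open>By \<open>const\<close> the right side of the relation takes the same value at
      \<open>m\<close> and at the identity, hence so does the sum of induced characters.\<close>
    have triv: "m \<in> H i \<and> lam i m = 1" if "i \<in> {1..t}" "m \<in> N" for i m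
    proof -
      have "(\<Sum>i=1..t. induced G (H i) (lam i) m) = (\<Sum>i=1..t. induced G (H i) (lam i) \<one>\<^bsub>G\<^esub>)"
        using sum[OF mem_carrier[OF that(2)]] sum[OF group.is_monoid[OF assms(1), THEN monoid.one_closed]]
          const[OF that(2)] by simp
      from kernel_of_induced_sum[OF N assms(2) finite_atLeastAtMost H lam that(2) this that(1)]
      show ?thesis .
    qed
    \<comment> \<open>The witnesses for the quotient are the images of the \<open>H i\<close> with
      the descended \<open>lam i\<close>; \<open>t\<close> and \<open>d\<close> stay the
      same.\<close>
    define H' where "H' i = (\<lambda>h. N #>\<^bsub>G\<^esub> h) ` H i" for i
    define lam' where "lam' i = (\<lambda>A\<in>H' i. the_elem (lam i ` A))" for i
    have desc: "subgroup (H' i) (G Mod N)"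
      "lam' i \<in> linear_characters ((G Mod N)\<lparr>carrier := H' i\<rparr>)"
      "g \<in> carrier G \<Longrightarrow> induced (G Mod N) (H' i) (lam' i) (N #>\<^bsub>G\<^esub> g) = induced G (H i) (lam i) g"
      if "i \<in> {1..t}" for i g
    proof -
      have "N \<subseteq> H i" and "\<And>m. m \<in> N \<Longrightarrow> lam i m = 1" using triv[OF that] by auto
      note d = linear_character_descends[OF N assms(2) H[OF that] this(1) lam[OF that] this(2)]
      show "subgroup (H' i) (G Mod N)" "lam' i \<in> linear_characters ((G Mod N)\<lparr>carrier := H' i\<rparr>)"
        unfolding lam'_def H'_def by (rule d; assumption)+
      show "induced (G Mod N) (H' i) (lam' i) (N #>\<^bsub>G\<^esub> g) = induced G (H i) (lam i) g"
        if "g \<in> carrier G" unfolding lam'_def H'_def by (rule d(3)[OF _ that]; assumption)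
    qed
    have "(\<Sum>i=1..t. induced (G Mod N) (H' i) (lam' i) A)
         = of_nat d * supercharacter (G Mod N) (deflate G N ` X) A" if A: "A \<in> carrier (G Mod N)" for A
    proof -
      obtain g where g: "g \<in> carrier G" "A = N #>\<^bsub>G\<^esub> g" using A by (auto simp: carrier_FactGroup)
      show ?thesis
        using sum[OF g(1)] supercharacter_deflate[OF N assms(2) XI ker g(1)] desc(3) g by simp
    qed
    then show ?thesis using d desc(1,2) by blast
  qed
  \<comment> \<open>The first component of \<open>quotient_theory\<close> consists exactly of the
    deflations of those \<open>X\<close> to which the claim above applies.\<close>
  then show ?thesis by (auto simp: quasi_monomial_def quotient_theory_def C)
qed

end
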